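(* Let $m_0\ge 1$ and let $0\leq t_1<t_2<\dots<t_{m_0}<2\pi$ be (not necessarily uniformly spaced) points. Let $\mathbf{N}=(N_1,N_2)\in\mathbb{Z}^2$ and suppose that $f\in B_{\mathbf{N}}$ with $\mu(I^{\mathbf{N}})\leq 2m_0$. Then $f$ is exactly recovered from the samples $f(t_p), f'(t_p)$, $1\le p\le m_0$, by the interpolation formula $$f(t)=\sum_{p=1}^{m_0}\bigl(f(t_p)\,\psi_p(t)+f'(t_p)\,\phi_p(t)\bigr)\qquad\text{for all } t .$$
   Context: Here $\mathrm{i}$ is the imaginary unit. For $\mathbf{N}=(N_1,N_2)\in\mathbb{Z}^2$ with $N_1\le N_2$, $I^{\mathbf{N}}=\{n\in\mathbb{Z}: N_1\le n\le N_2\}$, $\mu(I^{\mathbf{N}})=N_2-N_1+1$ is its cardinality, and $B_{\mathbf{N}}$ is the set of all functions of the form $f(t)=\sum_{n\in I^{\mathbf{N}}}a(n)e^{\mathrm{i}nt}$ with $a(n)\in\mathbb{C}$. Given the points $t_1,\dots,t_{m_0}$, let $\mathbf{H}=[v_{kj}]_{1\le k,j\le 2m_0}$ be the square matrix with entries $$v_{kj}=\begin{cases} e^{\mathrm{i}(N_1+k-1)t_p}, & j=2p-1,\\ \mathrm{i}(N_1+k-1)e^{\mathrm{i}(N_1+k-1)t_p}, & j=2p,\end{cases}\qquad 1\le p\le m_0 .$$ The matrix $\mathbf{H}$ is invertible (the points being distinct in $[0,2\pi)$). Let $w_j(k)$ denote the $(j,k)$ element of $\mathbf{H}^{-1}$.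 The interpolating functions are $$\phi_p(t)=\sum_{k=1}^{2m_0}w_{2p}(k)\,e^{\mathrm{i}(N_1+k-1)t},\qquad \psi_p(t)=\sum_{k=1}^{2m_0}w_{2p-1}(k)\,e^{\mathrm{i}(N_1+k-1)t},\qquad 1\le p\le m_0 .$$ *)

theory Defs
  imports "HOL-Analysis.Derivative" "Jordan_Normal_Form.Gauss_Jordan_Elimination"
begin

definition freq_band :: "int \<times> int \<Rightarrow> int set" where
  "freq_band N = {n. fst N \<le> n \<and> n \<le> snd N}"

definition bandlimited :: "int \<times> int \<Rightarrow> (real \<Rightarrow> complex) set" where
  "bandlimited N =
     {f. \<exists>a :: int \<Rightarrow> complex.
           f = (\<lambda>t. \<Sum>n\<in>freq_band N. a n * exp (\<i> * of_int n * of_real t))}"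

text \<open>In the following the row index \<open>k\<close>, the column index \<open>j\<close> and the index \<open>p\<close> of the
  points \<open>t p\<close> all start at \<open>1\<close>.\<close>

definition hermite_entry :: "int \<Rightarrow> (nat \<Rightarrow> real) \<Rightarrow> nat \<Rightarrow> nat \<Rightarrow> complex" where
  "hermite_entry N1 t k j =
     (let n = N1 + int k - 1 in
      if odd j then exp (\<i> * of_int n * of_real (t ((j + 1) div 2)))
      else \<i> * of_int n * exp (\<i> * of_int n * of_real (t (j div 2))))"

text \<open>Matrices of the library are indexed from \<open>0\<close>, hence the shifts by one here and in
  \<open>hermite_weight\<close>.\<close>

definition hermite_matrix :: "nat \<Rightarrow> int \<Rightarrow> (nat \<Rightarrow> real) \<Rightarrow> complex mat" where
  "hermite_matrix m0 N1 t =
     Matrix.mat (2 * m0) (2 * m0) (\<lambda>(k, j). hermite_entry N1 t (k + 1) (j + 1))"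

text \<open>The \<open>(j, k)\<close> entry of the inverse matrix. The function \<open>mat_inverse\<close> returns \<open>Some\<close> of the
  two-sided inverse exactly for invertible matrices; for a singular matrix the value below is
  unspecified.\<close>

definition hermite_weight :: "nat \<Rightarrow> int \<Rightarrow> (nat \<Rightarrow> real) \<Rightarrow> nat \<Rightarrow> nat \<Rightarrow> complex" where
  "hermite_weight m0 N1 t j k = the (mat_inverse (hermite_matrix m0 N1 t)) $$ (j - 1, k - 1)"

definition phi :: "nat \<Rightarrow> int \<Rightarrow> (nat \<Rightarrow> real) \<Rightarrow> nat \<Rightarrow> real \<Rightarrow> complex" where
  "phi m0 N1 t p x =
     (\<Sum>k = 1..2 * m0. hermite_weight m0 N1 t (2 * p) k
        * exp (\<i> * of_int (N1 + int k - 1) * of_real x))"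

definition psi :: "nat \<Rightarrow> int \<Rightarrow> (nat \<Rightarrow> real) \<Rightarrow> nat \<Rightarrow> real \<Rightarrow> complex" where
  "psi m0 N1 t p x =
     (\<Sum>k = 1..2 * m0. hermite_weight m0 N1 t (2 * p - 1) k
        * exp (\<i> * of_int (N1 + int k - 1) * of_real x))"

end

theory Submission
  imports Defs "HOL-Analysis.Complex_Transcendental" "Jordan_Normal_Form.Determinant"
begin

text \<open>A combination of the rows of the Hermite matrix \<open>H\<close> is, up to the factor \<open>exp (\<i> N\<^sub>1 x)\<close>, a
  polynomial of degree less than \<open>2 m\<^sub>0\<close> in \<open>exp (\<i> x)\<close>, together with its derivative, at the points
  \<open>x = t\<^sub>p\<close>. If the combination vanishes, the polynomial has double zeros at the \<open>m\<^sub>0\<close> distinct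
  points \<open>exp (\<i> t\<^sub>p)\<close>, hence is zero; so \<open>H\<close> is invertible. If \<open>c\<close> is the row of coefficients
  of \<open>f\<close>, padded by zeros, the row of samples of \<open>f\<close> and \<open>f'\<close> is \<open>c H\<close>, and multiplying it by
  the inverse of \<open>H\<close> recovers \<open>c\<close>.\<close>

text \<open>If \<open>q\<close> were nonzero, every point of \<open>S\<close> would be a root of
  order at least 2, while the orders of all roots add up to at most the degree.\<close>

lemma double_roots_imp_zero:
  fixes q :: "'a :: {idom, semiring_char_0} poly"
  assumes roots: "\<And>z. z \<in> S \<Longrightarrow> poly q z = 0" "\<And>z. z \<in> S \<Longrightarrow> poly (pderiv q) z = 0"
    and deg: "degree q < 2 * card S"
  shows "q = 0"
proof (rule ccontr)
  assume "q \<noteq> 0"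
  have "2 \<le> order z q" if "z \<in> S" for z
  proof -
    \<comment> \<open>A root forces positive order only for a nonzero polynomial. In characteristic
      zero a vanishing derivative makes \<open>q\<close> constant, and a constant with a root is
      zero.\<close>
    have "pderiv q \<noteq> 0"
    proof
      assume "pderiv q = 0"
      then obtain a where "q = [:a:]"
        by (metis pderiv_eq_0_iff degree_eq_zeroE)
      then show False
        using roots(1)[OF that] \<open>q \<noteq> 0\<close> by simp
    qed
    then have "order z (pderiv q) \<noteq> 0"
      using roots(2)[OF that] by (simp add: order_root)
    then show ?thesis
      using order_pderiv[OF \<open>q \<noteq> 0\<close> roots(1)[OF that]] by simp
  qed
  then have "(\<Sum>z\<in>S. 2) \<le> (\<Sum>z\<in>S. order z q)"
    by (intro sum_mono) auto
  also have "\<dots> \<le> (\<Sum>z | poly q z = 0. order z q)"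
    using roots(1) \<open>q \<noteq> 0\<close> by (intro sum_mono2) (auto simp: poly_roots_finite)
  also have "\<dots> \<le> degree q"
    by (rule sum_order_le_degree) fact
  finally show False
    using deg by simp
qed

lemma exp_shifted_frequency:
  "exp (\<i> * of_int (n + int k) * of_real x) = exp (\<i> * of_int n * of_real x) * exp (\<i> * of_real x) ^ k"
  by (simp add: ring_distribs exp_add mult_ac flip: exp_of_nat_mult)

lemma hermite_entry_exp:
  assumes "p \<ge> 1"
  shows "hermite_entry n t (k + 1) (2 * p - 1)
      = exp (\<i> * of_int n * of_real (t p)) * exp (\<i> * of_real (t p)) ^ k" (is ?value)
    and "hermite_entry n t (k + 1) (2 * p)
      = \<i> * of_int (n + int k) * (exp (\<i> * of_int n * of_real (t p)) * exp (\<i> * of_real (t p)) ^ k)"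
      (is ?derivative)
proof -
  have "n + int (k + 1) - 1 = n + int k" by simp
  then show ?value ?derivative
    using assms by (simp_all only: hermite_entry_def Let_def exp_shifted_frequency) auto
qed

text \<open>The exponents differ by less than one period \<open>2 * pi\<close> of the
  exponential.\<close>

lemma inj_on_exp_i_times:
  assumes "\<And>p. p \<in> A \<Longrightarrow> 0 \<le> t p \<and> t p < 2 * pi" and "inj_on t A"
  shows "inj_on (\<lambda>p. exp (\<i> * complex_of_real (t p))) A"
proof (rule inj_onI)
  fix p q assume pq: "p \<in> A" "q \<in> A" "exp (\<i> * complex_of_real (t p)) = exp (\<i> * of_real (t q))"
  have "\<bar>t p - t q\<bar> < 2 * pi"
    using assms(1)[OF pq(1)] assms(1)[OF pq(2)] by linarith
  then have "\<i> * complex_of_real (t p) = \<i> * of_real (t q)"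
    using pq(3) exp_complex_eqI[of "\<i> * of_real (t p)" "\<i> * of_real (t q)"] by simp
  then show "p = q"
    using assms(2) pq by (simp add: inj_on_def)
qed

lemma det_hermite_matrix_nonzero:
  assumes dist: "inj_on (\<lambda>p. exp (\<i> * complex_of_real (t p))) {1..m}"
  shows "det (hermite_matrix m n t) \<noteq> 0"
proof
  let ?H = "hermite_matrix m n t"
  have H: "?H \<in> carrier_mat (2 * m) (2 * m)"
    by (simp add: hermite_matrix_def)
  assume "det ?H = 0"
  \<comment> \<open>A kernel vector of the transpose is a vanishing combination of the rows, that
    is, of the frequencies.\<close>
  then have "det (transpose_mat ?H) = 0"
    using det_transpose[OF H] by simp
  then obtain v where v: "v \<in> carrier_vec (2 * m)" "v \<noteq> 0\<^sub>v (2 * m)"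
      "transpose_mat ?H *\<^sub>v v = 0\<^sub>v (2 * m)"
    using det_0_iff_vec_prod_zero[of "transpose_mat ?H"] H by auto
  have col: "(\<Sum>k<2 * m. hermite_entry n t (k + 1) (j + 1) * vec_index v k) = 0" if "j < 2 * m" for j
  proof -
    have "vec_index (transpose_mat ?H *\<^sub>v v) j = 0"
      using v that by simp
    then show ?thesis
      using that v(1) by (simp add: hermite_matrix_def scalar_prod_def atLeast0LessThan)
  qed
  define q where "q = (\<Sum>k<2 * m. monom (vec_index v k) k)"
  have coeff_q: "coeff q k = vec_index v k" if "k < 2 * m" for k
    using that by (simp add: q_def coeff_sum)
  have "q = 0"
  \<comment> \<open>For \<open>m = 0\<close> the strict degree bound below fails, but
    \<open>q\<close> is an empty sum.\<close>
  proof (cases "m = 0")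
    case True
    then show ?thesis by (simp add: q_def)
  next
    case False
    let ?z = "\<lambda>p. exp (\<i> * complex_of_real (t p))"
    show ?thesis
    proof (rule double_roots_imp_zero[of "?z ` {1..m}"])
      have "degree q \<le> 2 * m - 1"
        unfolding q_def by (intro degree_sum_le) (auto intro: order.trans[OF degree_monom_le])
      then show "degree q < 2 * card (?z ` {1..m})"
        unfolding card_image[OF dist] using False by simp
    next
      fix z assume "z \<in> ?z ` {1..m}"
      then obtain p where p: "p \<in> {1..m}" and z: "z = ?z p" by auto
      let ?e = "exp (\<i> * of_int n * of_real (t p))"
      have "0 = (\<Sum>k<2 * m. hermite_entry n t (k + 1) (2 * p - 1) * vec_index v k)"
        using col[of "2 * p - 2"] p by (cases p) auto
      also have "\<dots> = ?e * poly q z"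
        using p by (simp only: hermite_entry_exp atLeastAtMost_iff)
          (simp add: q_def poly_sum poly_monom sum_distrib_left z mult_ac)
      finally show root: "poly q z = 0" by simp
      have "0 = (\<Sum>k<2 * m. hermite_entry n t (k + 1) (2 * p) * vec_index v k)"
        using col[of "2 * p - 1"] p by (cases p) auto
      \<comment> \<open>The factor \<open>n + k\<close> splits: the part with \<open>n\<close> gives
        \<open>q\<close>, already known to vanish at \<open>z\<close>, and the part with
        \<open>k\<close> gives \<open>z\<close> times its derivative, where \<open>z\<close> is
        nonzero. At \<open>k = 0\<close> the truncated exponent \<open>k - 1\<close> is harmless
        because of the factor \<open>k\<close>.\<close>
      also have "\<dots> = (\<Sum>k<2 * m. \<i> * ?e * (of_int n * (vec_index v k * z ^ k)
            + z * (of_nat k * vec_index v k * z ^ (k - 1))))"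
      proof (intro sum.cong refl)
        fix k
        show "hermite_entry n t (k + 1) (2 * p) * vec_index v k = \<i> * ?e * (of_int n * (vec_index v k * z ^ k)
            + z * (of_nat k * vec_index v k * z ^ (k - 1)))"
          using p by (cases k) (simp_all only: hermite_entry_exp atLeastAtMost_iff, simp_all add: z algebra_simps)
      qed
      also have "\<dots> = \<i> * ?e * (of_int n * poly q z + z * poly (pderiv q) z)"
        by (simp add: q_def poly_sum poly_monom higher_pderiv_sum[where n = 1, simplified] pderiv_monom sum.distrib
            sum_distrib_left mult_ac distrib_left)
      finally show "poly (pderiv q) z = 0"
        using root by (simp add: z)
    qed
  qed
  then have "v = 0\<^sub>v (2 * m)"
    using coeff_q v(1) by (intro eq_vecI) auto
  then show False
    using v(2) by simp
qed

text \<open>The nonzero determinant makes \<open>mat_inverse\<close> return \<open>Some\<close>, so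
  the weights really are the entries of the inverse.\<close>

lemma hermite_entry_mult_weight:
  assumes "inj_on (\<lambda>p. exp (\<i> * complex_of_real (t p))) {1..m}"
    and k: "k \<in> {1..2 * m}" and l: "l \<in> {1..2 * m}"
  shows "(\<Sum>j = 1..2 * m. hermite_entry n t k j * hermite_weight m n t j l) = (if k = l then 1 else 0)"
proof -
  let ?H = "hermite_matrix m n t"
  have H: "?H \<in> carrier_mat (2 * m) (2 * m)"
    by (simp add: hermite_matrix_def)
  have "?H \<in> Units (ring_mat TYPE(complex) (2 * m) ())"
    by (rule det_non_zero_imp_unit[OF H det_hermite_matrix_nonzero[OF assms(1)]])
  then obtain B where B: "mat_inverse ?H = Some B"
    using mat_inverse(1)[OF H] by (metis option.exhaust)
  have HB: "?H * B = 1\<^sub>m (2 * m)" and dim: "B \<in> carrier_mat (2 * m) (2 * m)"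
    using mat_inverse(2)[OF H B] by auto
  have weight: "hermite_weight m n t j l = B $$ (j - 1, l - 1)" for j
    by (simp add: hermite_weight_def B)
  have "(\<Sum>j = 1..2 * m. hermite_entry n t k j * hermite_weight m n t j l)
      = (\<Sum>j<2 * m. hermite_entry n t k (j + 1) * hermite_weight m n t (j + 1) l)"
    by (rule sum.reindex_bij_witness[of _ "\<lambda>j. j + 1" "\<lambda>j. j - 1"]) auto
  also have "\<dots> = (?H * B) $$ (k - 1, l - 1)"
    using k l dim
    by (simp add: hermite_matrix_def weight scalar_prod_def atLeast0LessThan less_eq_Suc_le)
  also have "\<dots> = (if k = l then 1 else 0)"
    unfolding HB using k l by auto
  finally show ?thesis .
qed

lemma sum_odd_even_pairs:
  fixes g :: "nat \<Rightarrow> 'a :: comm_monoid_add"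
  shows "(\<Sum>p = 1..m. g (2 * p - 1) + g (2 * p)) = (\<Sum>j = 1..2 * m. g j)"
  by (induction m) (simp_all add: add.assoc)

lemma bandlimited_expansion:
  assumes "f \<in> bandlimited (N1, N2)" and "card (freq_band (N1, N2)) \<le> M"
  obtains c where "f = (\<lambda>x. \<Sum>k = 1..M. c k * exp (\<i> * of_int (N1 + int k - 1) * of_real x))"
proof -
  obtain a where a: "f = (\<lambda>x. \<Sum>n\<in>freq_band (N1, N2). a n * exp (\<i> * of_int n * of_real x))"
    using assms(1) by (auto simp: bandlimited_def)
  have band: "freq_band (N1, N2) = {N1..N2}"
    by (auto simp: freq_band_def)
  have len: "N2 - N1 + 1 \<le> int M"
    using assms(2) unfolding band by simp
  define c where "c k = (if N1 + int k - 1 \<le> N2 then a (N1 + int k - 1) else 0)" for k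
  have "f x = (\<Sum>k = 1..M. c k * exp (\<i> * of_int (N1 + int k - 1) * of_real x))" for x
  proof -
    have "f x = (\<Sum>k\<in>{k \<in> {1..M}. N1 + int k - 1 \<le> N2}.
        c k * exp (\<i> * of_int (N1 + int k - 1) * of_real x))"
      unfolding a band
      \<comment> \<open>The bound \<open>len\<close> ensures that every frequency of the band gets
        an index \<open>k\<close> at most \<open>M\<close>.\<close>
      by (rule sum.reindex_bij_witness[of _ "\<lambda>k. N1 + int k - 1" "\<lambda>n. nat (n - N1 + 1)"])
        (use len in \<open>auto simp: c_def\<close>)
    also have "\<dots> = (\<Sum>k = 1..M. c k * exp (\<i> * of_int (N1 + int k - 1) * of_real x))"
      by (rule sum.mono_neutral_left) (auto simp: c_def)
    finally show ?thesis .
  qed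
  then show thesis
    using that by blast
qed

theorem theorem4p2:
  fixes m0 :: nat and N1 N2 :: int and t :: "nat \<Rightarrow> real" and f :: "real \<Rightarrow> complex"
  assumes "m0 \<ge> 1"
    and "strict_mono_on {1..m0} t"
    and "\<forall>p\<in>{1..m0}. 0 \<le> t p \<and> t p < 2 * pi"
    and "N1 \<le> N2"
    and "f \<in> bandlimited (N1, N2)"
    and "card (freq_band (N1, N2)) \<le> 2 * m0"
  shows "\<forall>x. f x = (\<Sum>p = 1..m0. f (t p) * psi m0 N1 t p x
                       + vector_derivative f (at (t p)) * phi m0 N1 t p x)"
proof
  fix x
  define E where "E k x = exp (\<i> * of_int (N1 + int k - 1) * complex_of_real x)" for k x
  obtain c where f: "f = (\<lambda>x. \<Sum>k = 1..2 * m0. c k * E k x)"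
    using bandlimited_expansion[OF assms(5,6)] unfolding E_def .
  let ?h = "hermite_entry N1 t" and ?w = "hermite_weight m0 N1 t"
  \<comment> \<open>\<open>s\<close> is the row \<open>c\<close> times the Hermite matrix, and
    \<open>T j\<close> is the contribution of its entry \<open>s j\<close> to the interpolation
    sum.\<close>
  define s where "s j = (\<Sum>k = 1..2 * m0. c k * ?h k j)" for j
  define T where "T j = s j * (\<Sum>l = 1..2 * m0. ?w j l * E l x)" for j
  have inj: "inj_on (\<lambda>p. exp (\<i> * complex_of_real (t p))) {1..m0}"
    using assms(2,3) by (intro inj_on_exp_i_times strict_mono_on_imp_inj_on) auto
  have "(E k has_vector_derivative \<i> * of_int (N1 + int k - 1) * E k y) (at y)" for k y
    unfolding E_def
    by (rule has_vector_derivative_real_field) (auto intro!: derivative_eq_intros)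
  then have "(f has_vector_derivative (\<Sum>k = 1..2 * m0. c k * (\<i> * of_int (N1 + int k - 1) * E k y)))
      (at y)" for y
    unfolding f by (auto intro!: derivative_intros has_vector_derivative_mult_right)
  then have deriv: "vector_derivative f (at (t p)) = s (2 * p)" for p
    by (subst vector_derivative_at) (auto simp: s_def hermite_entry_def E_def intro!: sum.cong)
  \<comment> \<open>The range of \<open>p\<close> matters: at \<open>p = 0\<close> truncated
    subtraction would yield the even index 0.\<close>
  have val: "f (t p) = s (2 * p - 1)" if "p \<in> {1..m0}" for p
    using that by (simp add: f s_def hermite_entry_def E_def)
  have "(\<Sum>p = 1..m0. f (t p) * psi m0 N1 t p x + vector_derivative f (at (t p)) * phi m0 N1 t p x)
      = (\<Sum>p = 1..m0. T (2 * p - 1) + T (2 * p))"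
    by (intro sum.cong refl) (simp add: T_def psi_def phi_def deriv val E_def)
  also have "\<dots> = (\<Sum>j = 1..2 * m0. T j)"
    by (rule sum_odd_even_pairs)
  also have "\<dots> = (\<Sum>j = 1..2 * m0. \<Sum>l = 1..2 * m0. \<Sum>k = 1..2 * m0. c k * (?h k j * ?w j l) * E l x)"
    by (simp add: T_def s_def sum_distrib_left sum_distrib_right mult_ac)
  \<comment> \<open>Two exchanges bring the sum over \<open>j\<close> innermost, where it is an
    entry of the matrix times its inverse and collapses to a Kronecker delta.\<close>
  also have "\<dots> = (\<Sum>l = 1..2 * m0. \<Sum>j = 1..2 * m0. \<Sum>k = 1..2 * m0. c k * (?h k j * ?w j l) * E l x)"
    by (rule sum.swap)
  also have "\<dots> = (\<Sum>l = 1..2 * m0. \<Sum>k = 1..2 * m0. \<Sum>j = 1..2 * m0. c k * (?h k j * ?w j l) * E l x)"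
    by (intro sum.cong refl sum.swap)
  also have "\<dots> = (\<Sum>l = 1..2 * m0. \<Sum>k = 1..2 * m0. c k * (\<Sum>j = 1..2 * m0. ?h k j * ?w j l) * E l x)"
    by (simp only: sum_distrib_left sum_distrib_right)
  also have "\<dots> = (\<Sum>l = 1..2 * m0. \<Sum>k = 1..2 * m0. if k = l then c k * E l x else 0)"
    by (intro sum.cong refl, subst hermite_entry_mult_weight[OF inj]) auto
  also have "\<dots> = f x"
    by (simp add: f)
  finally show "f x = (\<Sum>p = 1..m0. f (t p) * psi m0 N1 t p x
      + vector_derivative f (at (t p)) * phi m0 N1 t p x)" ..
qed

end
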